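(* Let $X$ be a random variable uniformly distributed on $[0,1]$ (that is, $f_X=\mathcal{U}(0,1)$), let $n\in\mathbb{N}$, and let $B_1,\ldots,B_n$ be the bits in the $n$-bit binary expansion of $X$. Then the random variables $B_1,\ldots,B_n$ are independent.
   Context: The $n$-bit binary expansion of $X\in[0,1]$ is written $X = 0.B_1B_2\cdots B_n$, i.e. $X=\sum_{i=1}^n B_i (1/2)^i$ up to $n$-bit precision; it partitions $[0,1]$ into $2^n$ disjoint intervals of equal length. For each positive integer $i$, the $i$-th bit is $$B_i = \mathbb{I}\Big\{ X \in \bigcup_{j=1}^{2^{i-1}} \big[2^{-i}(2j-1),\, 2^{-i}\cdot 2j\big) \Big\},$$ where $\mathbb{I}\{A\}$ is the indicator of the event $A$ (with the last interval taken closed at the right endpoint $1$, so that $B_i=1$ when $X=1$). For example, $B_1 = 0$ if $X<1/2$ and $B_1=1$ if $X\ge 1/2$. $\mathcal{U}(0,1)$ denotes the uniform density on the unit interval. *)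

theory Defs
  imports "HOL-Probability.Probability"
begin

text \<open>
  The half-open intervals of length \<open>2\<^sup>-\<^sup>i\<close> on which the \<open>i\<close>-th bit is 1, for \<open>i \<ge> 1\<close>.
  The last one (\<open>j = 2 ^ (i - 1)\<close>) ends at 1; adjoining the point 1 closes it there.
\<close>
definition bit_set :: "nat \<Rightarrow> real set" where
  "bit_set i =
     (\<Union>j\<in>{1..2 ^ (i - 1)}. {(2 * real j - 1) / 2 ^ i ..< (2 * real j) / 2 ^ i}) \<union> {1}"

definition binary_bit :: "nat \<Rightarrow> real \<Rightarrow> real" where
  "binary_bit i x = indicator (bit_set i) x"

end

theory Submission
  imports Defs
begin

text \<open>
  On \<open>[0,1)\<close> the \<open>i\<close>-th bit of \<open>x\<close> is the parity of \<open>\<lfloor>2 ^ i * x\<rfloor>\<close>. Adding \<open>1 / 2 ^ b\<close> to a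
  point whose \<open>b\<close>-th bit is 0 turns that bit into 1 and leaves all earlier bits, and the integer
  part, unchanged. Translation preserves Lebesgue measure, so prescribing the value 1 for a
  further bit, later than those already prescribed, halves the measure. Hence the set on which
  the bits with index in \<open>J\<close> are all 1 has measure \<open>(1/2) ^ card J\<close>
  (\<open>measure_bits_one\<close>). The endpoint 1 is a null set, so the events that \<open>B\<^sub>i = 1\<close>
  satisfy the product rule. Finally, indicator variables are independent as soon as the events
  they indicate are (\<open>indep_vars_indicator\<close>).
\<close>

lemma (in prob_space) indep_vars_indicator:
  fixes E :: "'i \<Rightarrow> 'a set"
  assumes indep: "indep_events (\<lambda>i. E i \<inter> space M) I"
  shows "indep_vars (\<lambda>_. borel) (\<lambda>i \<omega>. indicator (E i) \<omega> :: real) I"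
  unfolding indep_vars_def2
proof
  have events: "E i \<inter> space M \<in> events" if "i \<in> I" for i
    using indep that by (auto simp: indep_events_def)
  show "\<forall>i\<in>I. random_variable borel (\<lambda>\<omega>. indicator (E i) \<omega> :: real)"
    using events by (simp add: borel_measurable_indicator_iff)
  \<comment> \<open>A singleton is a \<open>\<pi>\<close>-system, so independence passes from the events to the
      four-element sigma-algebras that they generate.\<close>
  have "indep_sets (\<lambda>i. sigma_sets (space M) {E i \<inter> space M}) I"
    using indep unfolding indep_events_def_alt
    by (rule indep_sets_sigma) (auto simp: Int_stable_def)
  then show "indep_sets (\<lambda>i. {(\<lambda>\<omega>. indicator (E i) \<omega> :: real) -` A \<inter> space M | A. A \<in> sets borel}) I"
  proof (rule indep_sets_mono_sets)
    fix i assume "i \<in> I"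
    let ?\<Sigma> = "sigma_sets (space M) {E i \<inter> space M}"
    have gen: "E i \<inter> space M \<in> ?\<Sigma>" "space M - E i \<inter> space M \<in> ?\<Sigma>"
      by (auto intro: sigma_sets.intros)
    have "(\<lambda>\<omega>. indicator (E i) \<omega> :: real) -` A \<inter> space M \<in> ?\<Sigma>" for A
    proof -
      have "(\<lambda>\<omega>. indicator (E i) \<omega> :: real) -` A \<inter> space M
          = (if 1 \<in> A then if 0 \<in> A then space M else E i \<inter> space M
             else if 0 \<in> A then space M - E i \<inter> space M else {})"
        by (auto simp: indicator_def of_bool_def split: if_splits)
      also have "\<dots> \<in> ?\<Sigma>"
        using gen by (auto intro: sigma_sets_top sigma_sets.Empty)
      finally show ?thesis .
    qed
    then show "{(\<lambda>\<omega>. indicator (E i) \<omega> :: real) -` A \<inter> space M | A. A \<in> sets borel} \<subseteq> ?\<Sigma>"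
      by blast
  qed
qed

lemma bit_set_measurable [measurable]: "bit_set i \<in> sets borel"
  unfolding bit_set_def by measurable

lemma bit_set_iff_odd_floor:
  assumes x: "0 \<le> x" "x < 1" and i: "1 \<le> i"
  shows "x \<in> bit_set i \<longleftrightarrow> odd \<lfloor>2 ^ i * x\<rfloor>"
proof
  assume "x \<in> bit_set i"
  then obtain j :: nat where "2 * real j - 1 \<le> 2 ^ i * x" "2 ^ i * x < 2 * real j"
    using x by (auto simp: bit_set_def field_simps)
  then have "\<lfloor>2 ^ i * x\<rfloor> = 2 * int j - 1"
    by (intro floor_unique) auto
  then show "odd \<lfloor>2 ^ i * x\<rfloor>" by simp
next
  assume "odd \<lfloor>2 ^ i * x\<rfloor>"
  then obtain k where k: "\<lfloor>2 ^ i * x\<rfloor> = 2 * k + 1" by (auto elim: oddE)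
  have "0 \<le> \<lfloor>2 ^ i * x\<rfloor>" using x by simp
  then have "0 \<le> k" using k by simp
  have "\<lfloor>2 ^ i * x\<rfloor> < 2 ^ i" using x by (simp add: floor_less_iff)
  then have "2 * k + 1 < 2 * 2 ^ (i - 1)"
    using k i by (simp flip: power_Suc)
  then have "k < 2 ^ (i - 1)" by simp
  define j where "j = nat (k + 1)"
  have "real j = of_int k + 1" "j \<in> {1..2 ^ (i - 1)}"
    using \<open>0 \<le> k\<close> \<open>k < 2 ^ (i - 1)\<close> by (auto simp: j_def nat_le_iff)
  moreover have "of_int (2 * k + 1) \<le> 2 ^ i * x" "2 ^ i * x < of_int (2 * k + 1) + 1"
    using k by linarith+
  ultimately show "x \<in> bit_set i"
    by (auto simp: bit_set_def field_simps intro!: bexI[of _ j])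
qed

lemma floor_pow2_shift_same:
  fixes x :: real
  shows "\<lfloor>2 ^ b * (x + 1 / 2 ^ b)\<rfloor> = \<lfloor>2 ^ b * x\<rfloor> + 1"
  by (simp add: distrib_left)

text \<open>
  With an even value of \<open>\<lfloor>2 ^ b * x\<rfloor>\<close> the addition of one unit in place \<open>b\<close> produces no carry.
\<close>
lemma floor_pow2_shift_less:
  fixes x :: real
  assumes even: "even \<lfloor>2 ^ b * x\<rfloor>" and "i < b"
  shows "\<lfloor>2 ^ i * (x + 1 / 2 ^ b)\<rfloor> = \<lfloor>2 ^ i * x\<rfloor>"
proof -
  obtain d where b: "b = i + Suc d"
    using \<open>i < b\<close> less_iff_Suc_add by auto
  have truncate: "\<lfloor>2 ^ i * y\<rfloor> = \<lfloor>2 ^ b * y\<rfloor> div 2 div 2 ^ d" for y :: real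
  proof -
    have "2 ^ i * y = 2 ^ b * y / of_int (2 * 2 ^ d)"
      by (simp add: b power_add)
    then have "\<lfloor>2 ^ i * y\<rfloor> = \<lfloor>2 ^ b * y / of_int (2 * 2 ^ d)\<rfloor>" by (rule arg_cong)
    also have "\<dots> = \<lfloor>2 ^ b * y\<rfloor> div (2 * 2 ^ d)"
      by (rule floor_divide_real_eq_div) simp
    finally show ?thesis by (simp add: zdiv_zmult2_eq)
  qed
  have "(\<lfloor>2 ^ b * x\<rfloor> + 1) div 2 = \<lfloor>2 ^ b * x\<rfloor> div 2"
    using even by simp
  then show ?thesis
    by (simp only: truncate floor_pow2_shift_same)
qed

text \<open>
  The unit interval is expressed as \<open>\<lfloor>x\<rfloor> = 0\<close>, which makes it the case \<open>i = 0\<close> of the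
  no-carry property.
\<close>
lemma measure_bits_one:
  assumes "finite J" and "\<And>i. i \<in> J \<Longrightarrow> 1 \<le> i"
  shows "measure lborel {x::real. \<lfloor>x\<rfloor> = 0 \<and> (\<forall>i\<in>J. odd \<lfloor>2 ^ i * x\<rfloor>)} = (1/2) ^ card J"
  using assms
proof (induction J rule: finite_linorder_max_induct)
  case empty
  have "{x::real. \<lfloor>x\<rfloor> = 0} = {0..<1}" by (auto simp: floor_eq_iff)
  then show ?case by simp
next
  case (insert b A)
  define D where "D J = {x::real. \<lfloor>x\<rfloor> = 0 \<and> (\<forall>i\<in>J. odd \<lfloor>2 ^ i * x\<rfloor>)}" for J
  define Z where "Z = {x \<in> D A. even \<lfloor>2 ^ b * x\<rfloor>}"
  have "b \<notin> A" "1 \<le> b" "finite A" using insert.hyps insert.prems by blast+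
  have D_sets: "D J \<in> sets borel" if "finite J" for J
    using that unfolding D_def by measurable
  have "Z = D A - D (insert b A)" by (auto simp: D_def Z_def)
  then have meas: "D (insert b A) \<in> sets borel" "Z \<in> sets borel"
    using D_sets \<open>finite A\<close> by auto
  have unit: "D J \<subseteq> {0..1}" for J by (auto simp: D_def floor_eq_iff)
  have fin: "emeasure lborel S \<noteq> \<infinity>" if "S \<subseteq> {0..1}" for S :: "real set"
    using emeasure_mono[OF that, of lborel] by (auto simp: top_unique)

  have shift: "x + 1 / 2 ^ b \<in> D (insert b A) \<longleftrightarrow> x \<in> Z" for x
  proof (cases "even \<lfloor>2 ^ b * x\<rfloor>")
    case True
    have "\<lfloor>x + 1 / 2 ^ b\<rfloor> = \<lfloor>x\<rfloor>"
      using floor_pow2_shift_less[OF True, of 0] \<open>1 \<le> b\<close> by simp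
    moreover have "\<lfloor>2 ^ i * (x + 1 / 2 ^ b)\<rfloor> = \<lfloor>2 ^ i * x\<rfloor>" if "i \<in> A" for i
      using floor_pow2_shift_less[OF True] insert.hyps that by blast
    ultimately show ?thesis
      using True by (auto simp: D_def Z_def floor_pow2_shift_same)
  next
    case False
    then show ?thesis by (simp add: D_def Z_def floor_pow2_shift_same)
  qed
  have "measure lborel (D (insert b A))
      = measure (distr lborel borel ((+) (1 / 2 ^ b))) (D (insert b A))"
    by (simp only: lborel_distr_plus)
  also have "\<dots> = measure lborel ((+) (1 / 2 ^ b) -` D (insert b A) \<inter> space lborel)"
    by (rule measure_distr) (simp_all add: meas)
  also have "(+) (1 / 2 ^ b) -` D (insert b A) \<inter> space lborel = Z"
    by (simp add: vimage_def add.commute[of "1 / 2 ^ b"] shift)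
  finally have eq: "measure lborel (D (insert b A)) = measure lborel Z" .

  have "D A = D (insert b A) \<union> Z" by (auto simp: D_def Z_def)
  then have "measure lborel (D A) = measure lborel (D (insert b A) \<union> Z)" by simp
  also have "\<dots> = measure lborel (D (insert b A)) + measure lborel Z"
  proof (rule measure_Union)
    have "Z \<subseteq> {0..1}" using unit[of A] by (auto simp: Z_def)
    then show "emeasure lborel (D (insert b A)) \<noteq> \<infinity>" "emeasure lborel Z \<noteq> \<infinity>"
      using fin unit by blast+
    show "D (insert b A) \<inter> Z = {}" by (auto simp: D_def Z_def)
  qed (simp_all add: meas)
  finally have "measure lborel (D (insert b A)) = measure lborel (D A) / 2"
    using eq by simp
  moreover have "measure lborel (D A) = (1/2) ^ card A"
    unfolding D_def by (rule insert.IH) (rule insert.prems, rule insertI2)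
  ultimately show ?case
    using \<open>finite A\<close> \<open>b \<notin> A\<close> by (simp add: D_def)
qed

lemma measure_INT_bit_set:
  assumes "finite J" "J \<noteq> {}" and pos: "\<And>i. i \<in> J \<Longrightarrow> 1 \<le> i"
  shows "measure lborel ((\<Inter>i\<in>J. bit_set i) \<inter> {0..1}) = (1/2) ^ card J"
proof -
  let ?D = "{x::real. \<lfloor>x\<rfloor> = 0 \<and> (\<forall>i\<in>J. odd \<lfloor>2 ^ i * x\<rfloor>)}"
  have "x \<in> (\<Inter>i\<in>J. bit_set i) \<inter> {0..1} \<longleftrightarrow> x \<in> ?D \<union> {1}" for x
  proof (cases "0 \<le> x \<and> x < 1")
    case True
    then have "\<lfloor>x\<rfloor> = 0" by (simp add: floor_eq_iff)
    with True pos show ?thesis by (auto simp: bit_set_iff_odd_floor)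
  next
    case False
    then show ?thesis by (auto simp: floor_eq_iff bit_set_def)
  qed
  then have "(\<Inter>i\<in>J. bit_set i) \<inter> {0..1} = ?D \<union> {1}" by blast
  moreover have "?D \<in> sets lborel"
    using \<open>finite J\<close> by measurable
  then have "measure lborel (?D \<union> {1}) = measure lborel ?D"
    by (intro measure_Un_null_set) auto
  ultimately show ?thesis
    using measure_bits_one[of J] assms by simp
qed

text \<open>
  The total mass of a distribution is 1, which forces the normalizing constant of a density
  that is constant on the unit interval to be 1.
\<close>
lemma (in prob_space) prob_uniform_unit_interval:
  fixes c :: real
  assumes X: "distributed M lborel X (\<lambda>x::real. ennreal (indicator {0..1} x / c))"
    and S: "S \<in> sets borel"
  shows "prob (X -` S \<inter> space M) = measure lborel (S \<inter> {0..1})"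
proof -
  have emeasure: "emeasure M (X -` A \<inter> space M) = ennreal (1 / c) * emeasure lborel (A \<inter> {0..1})"
    if A: "A \<in> sets borel" for A
  proof -
    have "emeasure M (X -` A \<inter> space M)
        = (\<integral>\<^sup>+x. ennreal (indicator {0..1} x / c) * indicator A x \<partial>lborel)"
      using X by (rule distributed_emeasure) (simp add: A)
    also have "\<dots> = (\<integral>\<^sup>+x. ennreal (1 / c) * indicator (A \<inter> {0..1}) x \<partial>lborel)"
      by (intro nn_integral_cong) (auto simp: indicator_def)
    also have "\<dots> = ennreal (1 / c) * emeasure lborel (A \<inter> {0..1})"
      using A by (intro nn_integral_cmult_indicator) auto
    finally show ?thesis .
  qed
  have "ennreal (1 / c) = 1"
    using emeasure[of UNIV] by (simp add: emeasure_space_1)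
  then show ?thesis
    using emeasure[OF S] by (simp add: measure_def)
qed

theorem proposition3p2:
  fixes M :: "'a measure" and X :: "'a \<Rightarrow> real" and n :: nat
  assumes "prob_space M"
    and "distributed M lborel X (\<lambda>x. indicator {0..1} x / measure lborel {0..1})"
  shows "prob_space.indep_vars M (\<lambda>_. borel) (\<lambda>i \<omega>. binary_bit i (X \<omega>)) {1..n}"
proof -
  interpret prob_space M by fact
  have [measurable]: "X \<in> borel_measurable M"
    using distributed_measurable[OF assms(2)] by simp
  have prob: "prob (\<Inter>i\<in>J. X -` bit_set i \<inter> space M) = (1/2) ^ card J"
    if J: "J \<subseteq> {1..n}" "finite J" "J \<noteq> {}" for J
  proof -
    have "(\<Inter>i\<in>J. X -` bit_set i \<inter> space M) = X -` (\<Inter>i\<in>J. bit_set i) \<inter> space M"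
      using \<open>J \<noteq> {}\<close> by auto
    also have "prob \<dots> = measure lborel ((\<Inter>i\<in>J. bit_set i) \<inter> {0..1})"
      using J by (intro prob_uniform_unit_interval[OF assms(2)] sets.finite_INT) auto
    also have "\<dots> = (1/2) ^ card J"
      using J by (intro measure_INT_bit_set) auto
    finally show ?thesis .
  qed
  have "indep_events (\<lambda>i. X -` bit_set i \<inter> space M) {1..n}"
  proof (rule indep_eventsI)
    fix J assume J: "J \<subseteq> {1..n}" "finite J" "J \<noteq> {}"
    have "prob (X -` bit_set i \<inter> space M) = 1/2" if "i \<in> J" for i
      using prob[of "{i}"] J that by auto
    then have "(\<Prod>i\<in>J. prob (X -` bit_set i \<inter> space M)) = (\<Prod>i\<in>J. 1/2)"
      by (intro prod.cong refl)
    also have "\<dots> = prob (\<Inter>i\<in>J. X -` bit_set i \<inter> space M)"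
      by (simp only: prob[OF J] prod_constant)
    finally show "prob (\<Inter>i\<in>J. X -` bit_set i \<inter> space M) = (\<Prod>i\<in>J. prob (X -` bit_set i \<inter> space M))"
      by (rule sym)
  qed measurable
  then have "indep_vars (\<lambda>_. borel) (\<lambda>i \<omega>. indicator (X -` bit_set i) \<omega> :: real) {1..n}"
    by (rule indep_vars_indicator)
  then show ?thesis
    by (simp add: binary_bit_def indicator_def)
qed

end
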